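(* Let $G$ and $H$ be groups, let $\phi : H \to G$ be a group homomorphism, and let $V$ be a vector space over a field $\mathbb{K}$. Let $\tau : V^G \to V^H$ be a $\phi$-cellular automaton with memory set $S \subset G$ and local defining map $\mu : V^S \to V$. Then $\tau$ is linear (that is, $\tau(x+x') = \tau(x)+\tau(x')$ and $\tau(kx) = k\tau(x)$ for all $x,x' \in V^G$ and $k \in \mathbb{K}$) if and only if $\mu$ is $\mathbb{K}$-linear.
   Context: $V^G$ is the set of all maps $x : G \to V$, a $\mathbb{K}$-vector space with pointwise operations; likewise $V^H$ and $V^S$. The group $G$ acts on $V^G$ on the left by $(g\cdot x)(g') = x(g^{-1}g')$. For a group homomorphism $\phi : H \to G$, a $\phi$-cellular automaton from $V^G$ to $V^H$ with memory set $S$ and local defining map $\mu$ is a map $\tau : V^G \to V^H$, where $S \subseteq G$ is a finite subset and $\mu : V^S \to V$ is a map, such that $\tau(x)(h) = \mu\big((\phi(h^{-1})\cdot x)|_S\big)$ for all $x \in V^G$ and $h \in H$, where $|_S$ denotes restriction to $S$. *)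

theory Defs
  imports "Jordan_Normal_Form.Missing_VectorSpace"
begin

text \<open>
  The space \<open>V\<^sup>I\<close> of all maps \<open>I \<rightarrow> V\<close> with pointwise operations. Maps on \<open>I\<close> are represented by
  extensional functions, so that equality in \<open>V\<^sup>I\<close> is HOL equality. The multiplicative fields are
  present only because a module record extends a ring record; as in \<open>func_space\<close>, they are filled
  with the zero map and play no role.
\<close>

definition map_space ::
    "'i set \<Rightarrow> ('k, 'v, 'm) module_scheme \<Rightarrow> ('k, 'i \<Rightarrow> 'v) module"
  where "map_space I V =
    \<lparr>carrier = I \<rightarrow>\<^sub>E carrier V,
     mult = (\<lambda>x y. \<lambda>i\<in>I. \<zero>\<^bsub>V\<^esub>),
     one = (\<lambda>i\<in>I. \<zero>\<^bsub>V\<^esub>),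
     zero = (\<lambda>i\<in>I. \<zero>\<^bsub>V\<^esub>),
     add = (\<lambda>x y. \<lambda>i\<in>I. x i \<oplus>\<^bsub>V\<^esub> y i),
     smult = (\<lambda>k x. \<lambda>i\<in>I. k \<odot>\<^bsub>V\<^esub> x i)\<rparr>"

lemma map_space_is_vs:
  assumes "vectorspace K V"
  shows "vectorspace K (map_space I V)"
proof -
  interpret V: vectorspace K V by fact
  show ?thesis
  proof (rule vs_criteria)
    show "\<forall>x\<in>carrier (map_space I V). \<exists>y\<in>carrier (map_space I V).
        x \<oplus>\<^bsub>map_space I V\<^esub> y = \<zero>\<^bsub>map_space I V\<^esub>"
    proof
      fix x assume "x \<in> carrier (map_space I V)"
      then show "\<exists>y\<in>carrier (map_space I V). x \<oplus>\<^bsub>map_space I V\<^esub> y = \<zero>\<^bsub>map_space I V\<^esub>"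
        by (intro bexI[of _ "\<lambda>i\<in>I. \<ominus>\<^bsub>V\<^esub> x i"])
          (auto simp: map_space_def PiE_iff V.M.r_neg intro!: restrict_ext)
    qed
  qed (use V.field_axioms in \<open>auto simp: map_space_def PiE_iff V.M.a_ac V.smult_l_distr
      V.smult_r_distr V.smult_assoc1 extensional_def fun_eq_iff restrict_def\<close>)
qed

text \<open>The left action \<open>(g \<cdot> x)(g') = x(g\<^sup>-\<^sup>1 g')\<close> of \<open>G\<close> on maps defined on \<open>G\<close>.\<close>

definition shift :: "('g, 'n) monoid_scheme \<Rightarrow> 'g \<Rightarrow> ('g \<Rightarrow> 'v) \<Rightarrow> ('g \<Rightarrow> 'v)"
  where "shift G g x = (\<lambda>g'\<in>carrier G. x (inv\<^bsub>G\<^esub> g \<otimes>\<^bsub>G\<^esub> g'))"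

definition cellular_automaton ::
    "('g, 'n) monoid_scheme \<Rightarrow> ('h, 'o) monoid_scheme \<Rightarrow> ('h \<Rightarrow> 'g) \<Rightarrow> 'v set
      \<Rightarrow> 'g set \<Rightarrow> (('g \<Rightarrow> 'v) \<Rightarrow> 'v) \<Rightarrow> (('g \<Rightarrow> 'v) \<Rightarrow> ('h \<Rightarrow> 'v)) \<Rightarrow> bool"
  where "cellular_automaton G H \<phi> A S \<mu> \<tau> \<longleftrightarrow>
    finite S \<and> S \<subseteq> carrier G \<and>
    \<mu> \<in> (S \<rightarrow>\<^sub>E A) \<rightarrow> A \<and>
    \<tau> \<in> (carrier G \<rightarrow>\<^sub>E A) \<rightarrow> (carrier H \<rightarrow>\<^sub>E A) \<and>
    (\<forall>x \<in> carrier G \<rightarrow>\<^sub>E A. \<forall>h \<in> carrier H.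
       \<tau> x h = \<mu> (restrict (shift G (\<phi> (inv\<^bsub>H\<^esub> h)) x) S))"

end

theory Submission
  imports Defs
begin

text \<open>
  Write \<open>r\<^sub>g\<close> for the map sending \<open>x\<close> to the restriction of \<open>g \<cdot> x\<close> to \<open>S\<close>. It is linear, so linearity
  of \<open>\<mu>\<close> passes to every coordinate \<open>\<mu> \<circ> r\<^sub>g\<close> of \<open>\<tau>\<close>. Conversely, extension by zero is a linear
  section of \<open>r\<^sub>1\<close>, hence \<open>\<mu>\<close> is extension by zero followed by \<open>\<tau>\<close> and evaluation at \<open>1\<close>.
\<close>

text \<open>The locale \<open>linear_map\<close> bundles the vector space axioms of both sides with
  the homomorphism property; once those axioms are given, only membership in
  \<open>module_hom\<close> remains.\<close>

lemma linear_map_iff_module_hom: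
  assumes "vectorspace K V" and "vectorspace K W"
  shows "linear_map K V W f \<longleftrightarrow> f \<in> module_hom K V W"
  using assms
  by (auto simp: linear_map_def mod_hom_def mod_hom_axioms_def vectorspace_def)

lemma module_hom_comp:
  assumes "f \<in> module_hom R L M" and "g \<in> module_hom R M N"
  shows "(\<lambda>x. g (f x)) \<in> module_hom R L N"
  using assms by (auto simp: module_hom_def Pi_iff)

text \<open>Membership in \<open>module_hom\<close> only involves values on the carrier, and
  \<open>module R M\<close> makes the carrier closed under sums and multiples. This permits
  exchanging maps such as \<open>\<tau> x h\<close> and its local formula, which are known to agree
  only on the carrier.\<close>

lemma module_hom_cong:
  assumes "module R M" and "\<And>x. x \<in> carrier M \<Longrightarrow> f x = g x"
  shows "f \<in> module_hom R M N \<longleftrightarrow> g \<in> module_hom R M N"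
proof -
  interpret M: module R M by fact
  show ?thesis
    using assms(2) by (auto simp: module_hom_def Pi_iff)
qed

lemma carrier_map_space: "carrier (map_space I V) = I \<rightarrow>\<^sub>E carrier V"
  by (simp add: map_space_def)

text \<open>Operations in \<open>map_space I V\<close> are pointwise, and extensional maps are equal
  once they agree on \<open>I\<close>, so each homomorphism equation splits into its
  coordinates.\<close>

lemma module_hom_into_map_space_iff:
  assumes "module R M" and "f \<in> carrier M \<rightarrow> carrier (map_space I V)"
  shows "f \<in> module_hom R M (map_space I V)
    \<longleftrightarrow> (\<forall>i\<in>I. (\<lambda>x. f x i) \<in> module_hom R M V)"
proof -
  interpret M: module R M by fact
  have mem: "f x \<in> I \<rightarrow>\<^sub>E carrier V" if "x \<in> carrier M" for x
    using assms(2) that by (auto simp: carrier_map_space)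
  have eq: "f x = restrict y I \<longleftrightarrow> (\<forall>i\<in>I. f x i = y i)" if "x \<in> carrier M" for x y
    using mem[OF that] by (auto simp: PiE_iff extensional_def fun_eq_iff restrict_def)
  show ?thesis
    using mem by (fastforce simp: module_hom_def map_space_def eq)
qed

text \<open>Every coordinate of the image is a coordinate of \<open>x\<close> or constantly zero,
  both linear in \<open>x\<close>. Serves for restricted shifts (\<open>P\<close> always true,
  \<open>p\<close> a translation) and for extension by zero (\<open>P\<close> membership in
  \<open>S\<close>, \<open>p\<close> the identity).\<close>

lemma reindex_module_hom:
  assumes "module R V" and "\<And>i. i \<in> I \<Longrightarrow> P i \<Longrightarrow> p i \<in> J"
  shows "(\<lambda>x. \<lambda>i\<in>I. if P i then x (p i) else \<zero>\<^bsub>V\<^esub>)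
    \<in> module_hom R (map_space J V) (map_space I V)"
proof -
  interpret V: module R V by fact
  show ?thesis
    using assms(2) by (auto simp: module_hom_def map_space_def PiE_iff fun_eq_iff)
qed

theorem proposition21:
  fixes G :: "('g, 'n) monoid_scheme" and H :: "('h, 'o) monoid_scheme"
    and K :: "('k, 'r) ring_scheme" and V :: "('k, 'v, 'm) module_scheme"
    and \<phi> :: "'h \<Rightarrow> 'g" and S :: "'g set"
    and \<mu> :: "('g \<Rightarrow> 'v) \<Rightarrow> 'v" and \<tau> :: "('g \<Rightarrow> 'v) \<Rightarrow> ('h \<Rightarrow> 'v)"
  assumes "group G" and "group H" and "\<phi> \<in> hom H G"
    and "field K" and "vectorspace K V"
    and "cellular_automaton G H \<phi> (carrier V) S \<mu> \<tau>"
  shows "linear_map K (map_space (carrier G) V) (map_space (carrier H) V) \<tau>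
    \<longleftrightarrow> linear_map K (map_space S V) V \<mu>"
proof -
  interpret G: group G by fact
  interpret H: group H by fact
  interpret \<phi>: group_hom H G \<phi>
    using assms(3) by unfold_locales
  interpret V: vectorspace K V by fact
  have module: "module K (map_space I V)" for I :: "'g set"
    using map_space_is_vs[OF assms(5)] by (auto simp: vectorspace_def)
  define r where "r g x = restrict (shift G g x) S" for g and x :: "'g \<Rightarrow> 'v"
  define e where "e y = (\<lambda>g\<in>carrier G. if g \<in> S then y g else \<zero>\<^bsub>V\<^esub>)" for y
  have S: "S \<subseteq> carrier G"
    and \<tau>: "\<tau> \<in> carrier (map_space (carrier G) V) \<rightarrow> carrier (map_space (carrier H) V)"
    using assms(6) by (auto simp: cellular_automaton_def carrier_map_space)
  have \<tau>_apply: "\<tau> x h = \<mu> (r (\<phi> (inv\<^bsub>H\<^esub> h)) x)"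
    if "x \<in> carrier (map_space (carrier G) V)" "h \<in> carrier H" for x h
    using assms(6) that by (auto simp: cellular_automaton_def carrier_map_space r_def)
  have r_hom: "r g \<in> module_hom K (map_space (carrier G) V) (map_space S V)"
    if "g \<in> carrier G" for g
  proof -
    \<comment> \<open>As \<open>S\<close> lies in \<open>carrier G\<close>, the inner restriction in
      \<open>shift\<close> has no effect on \<open>S\<close>. The trivial condition
      \<open>True\<close> brings the map into the shape of
      \<open>reindex_module_hom\<close>.\<close>
    have "r g = (\<lambda>x. \<lambda>s\<in>S. if True then x (inv\<^bsub>G\<^esub> g \<otimes>\<^bsub>G\<^esub> s) else \<zero>\<^bsub>V\<^esub>)"
      using S by (auto simp: r_def shift_def fun_eq_iff restrict_def)
    then show ?thesis
      using S that by (simp only:) (rule reindex_module_hom[OF V.module_axioms], auto)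
  qed
  have e_hom: "e \<in> module_hom K (map_space S V) (map_space (carrier G) V)"
    unfolding e_def by (rule reindex_module_hom[OF V.module_axioms])
  have r_e: "r \<one>\<^bsub>G\<^esub> (e y) = y" if "y \<in> carrier (map_space S V)" for y
    using that S
    by (auto simp: r_def shift_def e_def carrier_map_space PiE_iff extensional_def fun_eq_iff)
  \<comment> \<open>At the identity of \<open>H\<close> the shift is by the identity of
    \<open>G\<close>, since \<open>\<phi>\<close> preserves inverses and units; so the local formula
    reads \<open>\<mu>\<close> at \<open>y\<close> itself.\<close>
  have \<mu>_eq: "\<tau> (e y) \<one>\<^bsub>H\<^esub> = \<mu> y" if "y \<in> carrier (map_space S V)" for y
    using \<tau>_apply[OF funcset_mem[OF module_hom_closed[OF e_hom] that] H.one_closed] r_e[OF that]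
    by simp
  have "\<tau> \<in> module_hom K (map_space (carrier G) V) (map_space (carrier H) V)
    \<longleftrightarrow> \<mu> \<in> module_hom K (map_space S V) V"
    unfolding module_hom_into_map_space_iff[OF module \<tau>]
  proof
    assume "\<forall>h\<in>carrier H. (\<lambda>x. \<tau> x h) \<in> module_hom K (map_space (carrier G) V) V"
    then have "(\<lambda>y. \<tau> (e y) \<one>\<^bsub>H\<^esub>) \<in> module_hom K (map_space S V) V"
      by (intro module_hom_comp[OF e_hom]) auto
    then show "\<mu> \<in> module_hom K (map_space S V) V"
      by (rule module_hom_cong[OF module \<mu>_eq, THEN iffD1, rotated])
  next
    assume \<mu>: "\<mu> \<in> module_hom K (map_space S V) V"
    show "\<forall>h\<in>carrier H. (\<lambda>x. \<tau> x h) \<in> module_hom K (map_space (carrier G) V) V"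
    proof
      fix h assume h: "h \<in> carrier H"
      then have "(\<lambda>x. \<mu> (r (\<phi> (inv\<^bsub>H\<^esub> h)) x)) \<in> module_hom K (map_space (carrier G) V) V"
        by (intro module_hom_comp[OF r_hom \<mu>]) simp
      then show "(\<lambda>x. \<tau> x h) \<in> module_hom K (map_space (carrier G) V) V"
        by (rule module_hom_cong[OF module \<tau>_apply[OF _ h], THEN iffD2, rotated])
    qed
  qed
  then show ?thesis
    by (simp add: linear_map_iff_module_hom map_space_is_vs assms(5))
qed

end
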